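(* Let $n\ge 3$ and let $R_2$ be the $(n+2)$-dimensional complex solvable Leibniz algebra with basis $\{e_1,\dots,e_n,x,y\}$ and multiplication $$[e_1,e_1]=e_3,\quad [e_i,e_1]=e_{i+1}\ (3\le i\le n-1),\quad [e_1,x]=e_1,\quad [x,e_1]=-e_1,$$ $$[e_i,x]=(i-1)e_i\ (3\le i\le n),\quad [e_2,y]=e_2,\quad [y,e_2]=-e_2,$$ all other products of basis elements being zero. A linear map $\varphi:R_2\to R_2$ is an automorphism of $R_2$ if and only if there exist $\alpha,\beta,\gamma,\delta\in\mathbb{C}$ with $\alpha\gamma\neq 0$ such that $$\varphi(e_1)=\alpha e_1+\sum_{i=3}^n\frac{(-1)^i\alpha\beta^{i-2}}{(i-2)!}\,e_i,\qquad \varphi(e_2)=\gamma e_2,$$ $$\varphi(e_i)=\sum_{j=i}^n\frac{(-1)^{j-i}\alpha^{i-1}\beta^{j-i}}{(j-i)!}\,e_j\ \ (3\le i\le n),$$ $$\varphi(x)=\beta e_1+\sum_{i=3}^n\frac{(-1)^i\beta^{i-1}}{(i-1)!}\,e_i+x,\qquad \varphi(y)=\delta e_2+y.$$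
   Context: All algebras are over $\mathbb{C}$. A Leibniz algebra is a vector space $L$ with a bilinear product $[-,-]$ satisfying $[[x,y],z]=[[x,z],y]+[x,[y,z]]$ for all $x,y,z\in L$ (the product need not be antisymmetric). In multiplication tables, products of basis elements that are not listed are zero. An automorphism of $L$ is a bijective linear map $\varphi:L\to L$ with $\varphi([u,v])=[\varphi(u),\varphi(v)]$ for all $u,v\in L$. Convention: $t^0=1$ for every $t\in\mathbb{C}$, including $t=0$. *)

theory Defs
  imports Complex_Main
begin

locale leibniz_algebra = vector_space scale
  for scale :: "complex \<Rightarrow> 'a::ab_group_add \<Rightarrow> 'a" (infixr \<open>*s\<close> 75) +
  fixes br :: "'a \<Rightarrow> 'a \<Rightarrow> 'a"
  assumes linear_left: "Vector_Spaces.linear scale scale (\<lambda>u. br u v)"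
    and linear_right: "Vector_Spaces.linear scale scale (\<lambda>v. br u v)"
    and leibniz: "br (br u v) w = br (br u w) v + br u (br v w)"

definition leibniz_automorphism ::
    "(complex \<Rightarrow> 'a::ab_group_add \<Rightarrow> 'a) \<Rightarrow> ('a \<Rightarrow> 'a \<Rightarrow> 'a) \<Rightarrow> ('a \<Rightarrow> 'a) \<Rightarrow> bool" where
  "leibniz_automorphism scale br \<phi> \<longleftrightarrow>
     Vector_Spaces.linear scale scale \<phi> \<and> bij \<phi> \<and>
     (\<forall>u v. \<phi> (br u v) = br (\<phi> u) (\<phi> v))"

text \<open>
  The underlying vector space is the whole type. The basis is the family consisting of
  \<open>e i\<close> for \<open>1 \<le> i \<le> n\<close>, together with \<open>x\<close> and \<open>y\<close>; the cardinality assumption says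
  that these \<open>n + 2\<close> vectors are pairwise distinct. Values \<open>e i\<close> outside the range
  \<open>1 \<le> i \<le> n\<close> are irrelevant.
\<close>

locale R2_algebra = leibniz_algebra scale br
  for scale :: "complex \<Rightarrow> 'a::ab_group_add \<Rightarrow> 'a" (infixr \<open>*s\<close> 75)
    and br :: "'a \<Rightarrow> 'a \<Rightarrow> 'a" +
  fixes n :: nat and e :: "nat \<Rightarrow> 'a" and x y :: 'a
  assumes basis_card: "card (e ` {1..n} \<union> {x, y}) = n + 2"
    and basis_independent: "independent (e ` {1..n} \<union> {x, y})"
    and basis_span: "span (e ` {1..n} \<union> {x, y}) = UNIV"
    and br_e1_e1: "br (e 1) (e 1) = e 3"
    and br_ei_e1: "\<And>i. 3 \<le> i \<Longrightarrow> i \<le> n - 1 \<Longrightarrow> br (e i) (e 1) = e (i + 1)"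
    and br_e1_x: "br (e 1) x = e 1"
    and br_x_e1: "br x (e 1) = - e 1"
    and br_ei_x: "\<And>i. 3 \<le> i \<Longrightarrow> i \<le> n \<Longrightarrow> br (e i) x = of_nat (i - 1) *s e i"
    and br_e2_y: "br (e 2) y = e 2"
    and br_y_e2: "br y (e 2) = - e 2"
    and br_other: "\<And>b c. b \<in> e ` {1..n} \<union> {x, y} \<Longrightarrow> c \<in> e ` {1..n} \<union> {x, y} \<Longrightarrow>
        (b, c) \<notin> {(e 1, e 1), (e 1, x), (x, e 1), (e 2, y), (y, e 2)}
                 \<union> {(e i, e 1) | i. 3 \<le> i \<and> i \<le> n - 1}
                 \<union> {(e i, x) | i. 3 \<le> i \<and> i \<le> n} \<Longrightarrow>
        br b c = 0"

end

theory Submission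
  imports Defs
begin

text \<open>
  The right multiplication by \<open>e 1\<close> is a derivation, and the maps to be classified are the
  compositions of its exponential with parameter \<open>- \<beta>\<close> (whence the coefficients
  \<open>(- \<beta>) ^ k / fact k\<close>), of the rescaling \<open>e 1 \<mapsto> \<alpha> e 1\<close>, \<open>e i \<mapsto> \<alpha> ^ (i - 1) e i\<close>, and of an
  automorphism of the Lie subalgebra spanned by \<open>e 2\<close> and \<open>y\<close>.

  For necessity, the coordinates of a bracket are bilinear in the coordinates of its factors, and
  the relations between the images of \<open>e 1, e 2, x, y\<close> determine these images up to the four
  parameters. In particular \<open>[x, x] = 0\<close> and \<open>[x, e 1] = - e 1\<close> fix the coordinates of the images
  of \<open>x\<close> and \<open>e 1\<close> recursively. The remaining \<open>e i\<close> are iterated brackets of \<open>e 1\<close>.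
  For sufficiency, the relations are checked on the basis, where they reduce to
  \<open>k c\<^sub>k = - \<beta> c\<^sub>k\<^sub>-\<^sub>1\<close> for the exponential coefficients, and surjectivity holds because the
  map is triangular.
\<close>

section \<open>Exponential coefficients and their recursion\<close>

definition exp_coeff :: "complex \<Rightarrow> nat \<Rightarrow> complex" where
  "exp_coeff b k = (- b) ^ k / fact k"

lemma exp_coeff_0: "exp_coeff b 0 = 1"
  by (simp add: exp_coeff_def)

lemma exp_coeff_Suc: "of_nat (Suc k) * exp_coeff b (Suc k) = - b * exp_coeff b k"
  by (simp add: exp_coeff_def field_simps del: of_nat_Suc)

lemma exp_coeff_step:
  assumes "k \<ge> 1"
  shows "of_nat k * exp_coeff b k = - b * exp_coeff b (k - 1)"
  using exp_coeff_Suc[of "k - 1" b] assms by simp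

section \<open>Coordinates with respect to the given basis\<close>

locale R2_algebra_ge_3 = R2_algebra +
  assumes n_ge_3: "3 \<le> n"
begin

definition basis :: "'a set" where
  "basis = e ` {1..n} \<union> {x, y}"

lemma independent_basis: "independent basis" and span_basis: "span basis = UNIV"
  using basis_independent basis_span by (simp_all add: basis_def)

text \<open>The value 0 outside \<open>{1..n}\<close>, where \<open>e i\<close> is arbitrary, lets
  formulas such as \<open>co_e\<close> and \<open>coords_sum_e\<close> hold for every index
  \<open>i\<close>.\<close>

definition co :: "'a \<Rightarrow> nat \<Rightarrow> complex" where
  "co v i = (if 1 \<le> i \<and> i \<le> n then representation basis v (e i) else 0)"

definition cx :: "'a \<Rightarrow> complex" where "cx v = representation basis v x"

definition cy :: "'a \<Rightarrow> complex" where "cy v = representation basis v y"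

lemma finite_basis: "finite basis"
  by (simp add: basis_def)

text \<open>The cardinality \<open>n + 2\<close> is the largest possible: it forces equality in the
  bounds \<open>n\<close> and 2 for the two parts of the union, and disjointness of these
  parts.\<close>

lemma basis_distinct:
  shows e_inj: "inj_on e {1..n}"
    and x_notin: "x \<notin> e ` {1..n}" and y_notin: "y \<notin> e ` {1..n}" and x_neq_y: "x \<noteq> y"
proof -
  have le: "card (e ` {1..n}) \<le> n"
    using card_image_le[of "{1..n}" e] by simp
  have "card (e ` {1..n} \<union> {x, y}) \<le> card (e ` {1..n}) + card {x, y}"
    by (rule card_Un_le)
  moreover have "card {x, y} \<le> 2"
    by (simp add: card_insert_if)
  ultimately have eq: "card (e ` {1..n}) = n" "card {x, y} = 2"
    using le basis_card by auto
  show "inj_on e {1..n}"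
    using eq(1) by (intro eq_card_imp_inj_on) auto
  show "x \<noteq> y"
    using eq(2) by auto
  have "card (e ` {1..n} \<inter> {x, y}) = 0"
    using card_Un_Int[of "e ` {1..n}" "{x, y}"] eq basis_card by auto
  then have "e ` {1..n} \<inter> {x, y} = {}"
    by simp
  then show "x \<notin> e ` {1..n}" "y \<notin> e ` {1..n}"
    by auto
qed

lemma e_eq_iff: "1 \<le> i \<Longrightarrow> i \<le> n \<Longrightarrow> 1 \<le> j \<Longrightarrow> j \<le> n \<Longrightarrow> e i = e j \<longleftrightarrow> i = j"
  using e_inj by (auto dest: inj_onD)

lemma e_neq:
  assumes "1 \<le> i" "i \<le> n"
  shows "e i \<noteq> x" "e i \<noteq> y" "x \<noteq> e i" "y \<noteq> e i"
  using x_notin y_notin assms by force+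

lemma in_basis: "1 \<le> i \<Longrightarrow> i \<le> n \<Longrightarrow> e i \<in> basis" "x \<in> basis" "y \<in> basis"
  by (auto simp: basis_def)

lemma co_e: "1 \<le> j \<Longrightarrow> j \<le> n \<Longrightarrow> co (e j) i = (if i = j then 1 else 0)"
  by (auto simp: co_def representation_basis independent_basis in_basis e_eq_iff)

lemma co_xy: "co x i = 0" "co y i = 0"
  by (auto simp: co_def representation_basis independent_basis in_basis e_neq)

lemma cx_basis: "1 \<le> j \<Longrightarrow> j \<le> n \<Longrightarrow> cx (e j) = 0" "cx x = 1" "cx y = 0"
  using x_neq_y by (auto simp: cx_def representation_basis independent_basis in_basis e_neq)

lemma cy_basis: "1 \<le> j \<Longrightarrow> j \<le> n \<Longrightarrow> cy (e j) = 0" "cy x = 0" "cy y = 1"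
  using x_neq_y by (auto simp: cy_def representation_basis independent_basis in_basis e_neq)

lemma co_linear:
  "co 0 i = 0" "co (u + v) i = co u i + co v i" "co (c *s v) i = c * co v i"
  "co (- v) i = - co v i" "co (u - v) i = co u i - co v i"
  using independent_basis span_basis
  by (auto simp: co_def representation_zero representation_add representation_scale
      representation_neg representation_diff)

lemma cx_linear:
  "cx 0 = 0" "cx (u + v) = cx u + cx v" "cx (c *s v) = c * cx v" "cx (- v) = - cx v"
  "cx (u - v) = cx u - cx v"
  using independent_basis span_basis
  by (auto simp: cx_def representation_zero representation_add representation_scale
      representation_neg representation_diff)

lemma cy_linear:
  "cy 0 = 0" "cy (u + v) = cy u + cy v" "cy (c *s v) = c * cy v" "cy (- v) = - cy v"
  "cy (u - v) = cy u - cy v"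
  using independent_basis span_basis
  by (auto simp: cy_def representation_zero representation_add representation_scale
      representation_neg representation_diff)

lemmas coords = co_e co_xy cx_basis cy_basis co_linear cx_linear cy_linear

lemma coords_sum:
  "co (sum f A) i = (\<Sum>a\<in>A. co (f a) i)"
  "cx (sum f A) = (\<Sum>a\<in>A. cx (f a))" "cy (sum f A) = (\<Sum>a\<in>A. cy (f a))"
  by (induction A rule: infinite_finite_induct) (simp_all add: coords)

lemma coords_sum_e:
  assumes "1 \<le> k"
  shows "co (\<Sum>j = k..n. f j *s e j) i = (if k \<le> i \<and> i \<le> n then f i else 0)"
    and "cx (\<Sum>j = k..n. f j *s e j) = 0" and "cy (\<Sum>j = k..n. f j *s e j) = 0"
proof -
  have "co (\<Sum>j = k..n. f j *s e j) i = (\<Sum>j = k..n. if j = i then f j else 0)"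
    unfolding coords_sum using assms by (intro sum.cong) (auto simp: coords)
  then show "co (\<Sum>j = k..n. f j *s e j) i = (if k \<le> i \<and> i \<le> n then f i else 0)"
    by simp
qed (use assms in \<open>auto simp: coords_sum coords intro!: sum.neutral\<close>)

text \<open>A vector is the sum of its representation over the finite basis. This turns every
  equation between vectors below into scalar equations.\<close>

lemma coords_eqI:
  assumes "\<And>i. 1 \<le> i \<Longrightarrow> i \<le> n \<Longrightarrow> co u i = co v i" "cx u = cx v" "cy u = cy v"
  shows "u = v"
proof -
  have "representation basis u b = representation basis v b" if b: "b \<in> basis" for b
    proof -
    consider i where "1 \<le> i" "i \<le> n" "b = e i" | "b = x" | "b = y"
      using b by (auto simp: basis_def)
    then show ?thesis
      using assms by cases (auto simp: co_def cx_def cy_def)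
  qed
  then have "(\<Sum>b\<in>basis. representation basis u b *s b) = (\<Sum>b\<in>basis. representation basis v b *s b)"
    by (intro sum.cong) auto
  then show ?thesis
    using sum_representation_eq[OF independent_basis, of _ basis] span_basis
    by (auto simp: finite_basis)
qed

text \<open>Nested once per factor, this rule reduces bilinear identities to the multiplication
  table.\<close>

lemma basis_induct [case_names e x y zero add scale]:
  assumes "\<And>i. 1 \<le> i \<Longrightarrow> i \<le> n \<Longrightarrow> P (e i)" "P x" "P y"
    and "P 0" "\<And>u v. P u \<Longrightarrow> P v \<Longrightarrow> P (u + v)" "\<And>c v. P v \<Longrightarrow> P (c *s v)"
  shows "P v"
proof (rule span_induct[of v basis P])
  show "v \<in> span basis"
    using span_basis by simp
  show "subspace (Collect P)"
    using assms(4-6) by (auto simp: subspace_def)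
qed (use assms(1-3) in \<open>auto simp: basis_def\<close>)

section \<open>The bracket on the basis and in coordinates\<close>

lemma br_linear:
  "br 0 v = 0" "br u 0 = 0"
  "br (u + u') v = br u v + br u' v" "br u (v + v') = br u v + br u v'"
  "br (c *s u) v = c *s br u v" "br u (c *s v) = c *s br u v"
proof -
  interpret l: Vector_Spaces.linear scale scale "\<lambda>u. br u v" for v by (rule linear_left)
  interpret r: Vector_Spaces.linear scale scale "\<lambda>v. br u v" for u by (rule linear_right)
  show "br 0 v = 0" "br u 0 = 0"
    "br (u + u') v = br u v + br u' v" "br u (v + v') = br u v + br u v'"
    "br (c *s u) v = c *s br u v" "br u (c *s v) = c *s br u v"
    by (rule l.zero r.zero l.add r.add l.scale r.scale)+
qed

lemma br_e_e:
  assumes "1 \<le> i" "i \<le> n" "1 \<le> j" "j \<le> n"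
  shows "br (e i) (e j) =
    (if j = 1 then if i = 1 then e 3 else if 3 \<le> i \<and> i < n then e (i + 1) else 0 else 0)"
proof (cases "j = 1 \<and> (i = 1 \<or> 3 \<le> i \<and> i < n)")
  case True
  then show ?thesis using br_e1_e1 br_ei_e1[of i] by auto
next
  case False
  have "br (e i) (e j) = 0"
    using False assms by (intro br_other) (auto simp: e_eq_iff e_neq)
  then show ?thesis using False by auto
qed

lemma br_e_x:
  assumes "1 \<le> i" "i \<le> n"
  shows "br (e i) x = (if i = 1 then e 1 else if i = 2 then 0 else of_nat (i - 1) *s e i)"
proof (cases "i = 2")
  case True
  have "br (e i) x = 0"
    using True assms n_ge_3 x_neq_y by (intro br_other) (auto simp: e_eq_iff e_neq)
  then show ?thesis using True by auto
next
  case False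
  then show ?thesis using br_e1_x br_ei_x[of i] assms by (cases "i = 1") auto
qed

lemma br_e_y:
  assumes "1 \<le> i" "i \<le> n"
  shows "br (e i) y = (if i = 2 then e 2 else 0)"
proof (cases "i = 2")
  case True
  then show ?thesis using br_e2_y by auto
next
  case False
  have "br (e i) y = 0"
    using False assms n_ge_3 x_neq_y by (intro br_other) (auto simp: e_eq_iff e_neq)
  then show ?thesis using False by auto
qed

lemma br_x_e:
  assumes "1 \<le> i" "i \<le> n"
  shows "br x (e i) = (if i = 1 then - e 1 else 0)"
proof (cases "i = 1")
  case True
  then show ?thesis using br_x_e1 by auto
next
  case False
  have "br x (e i) = 0"
    using False assms n_ge_3 x_neq_y by (intro br_other) (auto simp: e_eq_iff e_neq)
  then show ?thesis using False by auto
qed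

lemma br_y_e:
  assumes "1 \<le> i" "i \<le> n"
  shows "br y (e i) = (if i = 2 then - e 2 else 0)"
proof (cases "i = 2")
  case True
  then show ?thesis using br_y_e2 by auto
next
  case False
  have "br y (e i) = 0"
    using False assms n_ge_3 x_neq_y by (intro br_other) (auto simp: e_eq_iff e_neq)
  then show ?thesis using False by auto
qed

lemma br_xy:
  "br x x = 0" "br x y = 0" "br y x = 0" "br y y = 0"
  using n_ge_3 x_neq_y by (intro br_other; auto simp: e_eq_iff e_neq)+

lemmas br_basis = br_e_e br_e_x br_e_y br_x_e br_y_e br_xy

text \<open>No product in the table has a component along \<open>x\<close> or
  \<open>y\<close>.\<close>

lemma cxy_br:
  shows cx_br: "cx (br u v) = 0" and cy_br: "cy (br u v) = 0"
proof -
  have "cx (br u v) = 0 \<and> cy (br u v) = 0"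
  proof (induction u rule: basis_induct)
    case (e i)
    show ?case
      by (induction v rule: basis_induct)
        (use n_ge_3 e in \<open>auto simp: br_basis br_linear coords\<close>)
  next
    case x
    show ?case
      by (induction v rule: basis_induct)
        (use n_ge_3 in \<open>auto simp: br_basis br_linear coords\<close>)
  next
    case y
    show ?case
      by (induction v rule: basis_induct)
        (use n_ge_3 in \<open>auto simp: br_basis br_linear coords\<close>)
  qed (auto simp: br_linear coords)
  then show "cx (br u v) = 0" "cy (br u v) = 0" by auto
qed

text \<open>This is the whole table in coordinates. Right multiplication by \<open>e 1\<close>
  shifts indices along the chain 1, 3, 4, ..., \<open>n\<close>, so the predecessor of 3 is 1; right
  multiplication by \<open>x\<close> is diagonal.\<close>

lemma co_br:
  assumes "1 \<le> k" "k \<le> n"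
  shows "co (br u v) k =
    (if k = 1 then co u 1 * cx v - cx u * co v 1
     else if k = 2 then co u 2 * cy v - cy u * co v 2
     else (if k = 3 then co u 1 else co u (k - 1)) * co v 1 + of_nat (k - 1) * co u k * cx v)"
proof (induction u rule: basis_induct)
  case (e i)
  show ?case
    by (induction v rule: basis_induct)
      (use n_ge_3 assms e in \<open>auto simp: br_basis br_linear coords algebra_simps\<close>)
next
  case x
  show ?case
    by (induction v rule: basis_induct)
      (use n_ge_3 assms in \<open>auto simp: br_basis br_linear coords algebra_simps\<close>)
next
  case y
  show ?case
    by (induction v rule: basis_induct)
      (use n_ge_3 assms in \<open>auto simp: br_basis br_linear coords algebra_simps\<close>)
qed (use n_ge_3 assms in \<open>auto simp: br_linear coords algebra_simps\<close>)

section \<open>Necessity: every automorphism has the normal form\<close>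

definition normal_form ::
    "('a \<Rightarrow> 'a) \<Rightarrow> complex \<Rightarrow> complex \<Rightarrow> complex \<Rightarrow> complex \<Rightarrow> bool" where
  "normal_form \<phi> \<alpha> \<beta> \<gamma> \<delta> \<longleftrightarrow>
     \<phi> (e 1) = \<alpha> *s e 1 + (\<Sum>i = 3..n. (\<alpha> * exp_coeff \<beta> (i - 2)) *s e i) \<and>
     \<phi> (e 2) = \<gamma> *s e 2 \<and>
     (\<forall>i. 3 \<le> i \<and> i \<le> n \<longrightarrow>
        \<phi> (e i) = (\<Sum>j = i..n. (\<alpha> ^ (i - 1) * exp_coeff \<beta> (j - i)) *s e j)) \<and>
     \<phi> x = \<beta> *s e 1 + (\<Sum>i = 3..n. (- exp_coeff \<beta> (i - 1)) *s e i) + x \<and>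
     \<phi> y = \<delta> *s e 2 + y"

text \<open>Each step reads off one coordinate of one relation between the images, in an order in
  which a single unknown remains. Injectivity enters through \<open>\<phi> (e 3) \<noteq> 0\<close>
  and \<open>\<phi> (e 2) \<noteq> 0\<close>.\<close>

lemma automorphism_imp_normal_form:
  assumes "leibniz_automorphism scale br \<phi>"
  obtains \<alpha> \<beta> \<gamma> \<delta> where "\<alpha> * \<gamma> \<noteq> 0" "normal_form \<phi> \<alpha> \<beta> \<gamma> \<delta>"
proof -
  from assms have hom: "\<phi> (br u v) = br (\<phi> u) (\<phi> v)" and inj: "inj \<phi>"
    and lin: "Vector_Spaces.linear scale scale \<phi>" for u v
    by (auto simp: leibniz_automorphism_def bij_def)
  interpret \<phi>: Vector_Spaces.linear scale scale \<phi> by (rule lin)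
  have ker: "\<phi> v = 0 \<Longrightarrow> v = 0" for v
    using inj \<phi>.zero by (metis injD)
  note n = n_ge_3 and One_nat_def [simp del]
  have e_neq_0: "e i \<noteq> 0" if "1 \<le> i" "i \<le> n" for i
    using co_e[OF that, of i] co_linear(1)[of i] by auto
  define a b X Y where defs: "a = \<phi> (e 1)" "b = \<phi> (e 2)" "X = \<phi> x" "Y = \<phi> y"
  have e1_e1: "br a a = \<phi> (e 3)" and e1_x: "br a X = a" and x_e1: "br X a = - a"
    and e1_y: "br a Y = 0" and e2_y: "br b Y = b" and e2_e2: "br b b = 0"
    and e2_x: "br b X = 0" and x_x: "br X X = 0" and x_y: "br X Y = 0"
    and y_x: "br Y X = 0"
    using n by (simp_all add: defs br_basis \<phi>.zero \<phi>.neg flip: hom)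
  \<comment> \<open>Both \<open>a = [a, X]\<close> and \<open>b = [b, Y]\<close> are
    brackets.\<close>
  have cxy: "cx a = 0" "cy a = 0" "cx b = 0" "cy b = 0"
    using cx_br[of a X] cy_br[of a X] cx_br[of b Y] cy_br[of b Y] e1_x e2_y by auto
  \<comment> \<open>Since \<open>cx b = 0\<close>, coordinate 3 of \<open>[b, b] = 0\<close> is the
    square of \<open>co b 1\<close>.\<close>
  have b1: "co b 1 = 0"
    using co_br[of 3 b b] n by (simp add: e2_e2 cxy coords)
  \<comment> \<open>Otherwise \<open>[a, a]\<close> would vanish in all coordinates, but it is the
    image of \<open>e 3\<close>.\<close>
  have a1: "co a 1 \<noteq> 0"
  proof
    assume "co a 1 = 0"
    then have "br a a = 0"
      using n by (intro coords_eqI) (auto simp: co_br cxy_br coords cxy)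
    then show False
      using ker[of "e 3"] e_neq_0[of 3] n by (simp add: e1_e1)
  qed
  have X_x: "cx X = 1"
    using co_br[of 1 a X] n a1 by (simp add: e1_x cxy)
  \<comment> \<open>Coordinate \<open>i\<close> of \<open>[b, X] = 0\<close> equates
    \<open>(i - 1) * co b i\<close> to a multiple of the preceding coordinate on the chain, which is
    already 0.\<close>
  have bi: "co b i = 0" if "3 \<le> i" "i \<le> n" for i
    using that
  proof (induction i rule: nat_induct_at_least)
    case base
    then show ?case
      using co_br[of 3 b X] n by (simp add: e2_x cxy coords b1 X_x)
  next
    case (Suc i)
    then show ?case
      using co_br[of "Suc i" b X] n by (simp add: e2_x cxy coords X_x)
  qed
  have b: "b = co b 2 *s e 2"
  proof (rule coords_eqI)
    fix i assume "1 \<le> i" "i \<le> n"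
    then show "co b i = co (co b 2 *s e 2) i"
      using n b1 bi[of i] by (cases "i = 1"; cases "i = 2") (auto simp: coords)
  qed (use n in \<open>auto simp: coords cxy\<close>)
  have b2: "co b 2 \<noteq> 0"
  proof
    assume "co b 2 = 0"
    then have "b = 0" using b by simp
    then show False using ker[of "e 2"] e_neq_0[of 2] n by (simp add: defs)
  qed
  \<comment> \<open>From here to \<open>X2\<close>, coordinates 1 and 2 of the relations leave one
    unknown each, with coefficient \<open>co b 2\<close>, \<open>co a 1\<close> or 1 up to
    sign.\<close>
  have X_y: "cy X = 0"
    using co_br[of 2 b X] n b2 by (simp add: e2_x cxy coords)
  have Y_y: "cy Y = 1"
    using co_br[of 2 b Y] n b2 by (simp add: e2_y cxy)
  have a2: "co a 2 = 0"
    using co_br[of 2 a X] n by (simp add: e1_x cxy X_y)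
  have Y_x: "cx Y = 0"
    using co_br[of 1 a Y] n a1 by (simp add: e1_y cxy coords)
  have Y1: "co Y 1 = 0"
    using co_br[of 1 X Y] n by (simp add: x_y coords Y_x X_x)
  have X2: "co X 2 = 0"
    using co_br[of 2 X Y] n by (simp add: x_y coords Y_y X_y)
  have Yi: "co Y i = 0" if "3 \<le> i" "i \<le> n" for i
    using that
  proof (induction i rule: nat_induct_at_least)
    case base
    then show ?case
      using co_br[of 3 Y X] n by (simp add: y_x coords Y1 X_x)
  next
    case (Suc i)
    then show ?case
      using co_br[of "Suc i" Y X] n by (simp add: y_x coords X_x)
  qed
  have Y: "Y = co Y 2 *s e 2 + y"
  proof (rule coords_eqI)
    fix i assume "1 \<le> i" "i \<le> n"
    then show "co Y i = co (co Y 2 *s e 2 + y) i"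
      using n Y1 Yi[of i] by (cases "i = 1"; cases "i = 2") (auto simp: coords)
  qed (use n in \<open>auto simp: coords Y_x Y_y\<close>)
  define \<alpha> \<beta> where "\<alpha> = co a 1" "\<beta> = co X 1"
  \<comment> \<open>Coordinate \<open>i + 1\<close> of \<open>[X, X] = 0\<close> is the recursion of
    the exponential coefficients. It starts at coordinate 3, whose predecessor is
    \<open>co X 1 = \<beta>\<close>.\<close>
  have Xi: "co X i = - exp_coeff \<beta> (i - 1)" if "3 \<le> i" "i \<le> n" for i
    using that
  proof (induction i rule: nat_induct_at_least)
    case base
    have "\<beta> * \<beta> + 2 * co X 3 = 0"
      using co_br[of 3 X X] n by (simp add: x_x coords X_x flip: \<alpha>_\<beta>_def(2))
    then show ?case
      by (simp add: exp_coeff_def power2_eq_square add_eq_0_iff field_simps)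
  next
    case (Suc i)
    have "of_nat i * co X (Suc i) = - (co X i * \<beta>)"
      using co_br[of "Suc i" X X] Suc.hyps Suc.prems
      by (simp add: x_x coords X_x \<alpha>_\<beta>_def add_eq_0_iff)
    also have "\<dots> = of_nat i * (- exp_coeff \<beta> i)"
      using Suc exp_coeff_step[of i \<beta>] by (simp add: mult_ac)
    finally show ?case
      using Suc.hyps by (subst (asm) mult_left_cancel) auto
  qed
  have X: "X = \<beta> *s e 1 + (\<Sum>i = 3..n. (- exp_coeff \<beta> (i - 1)) *s e i) + x"
  proof (rule coords_eqI)
    fix i assume "1 \<le> i" "i \<le> n"
    then show "co X i = co (\<beta> *s e 1 + (\<Sum>i = 3..n. (- exp_coeff \<beta> (i - 1)) *s e i) + x) i"
      using n X2 Xi[of i]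
      by (cases "i = 1"; cases "i = 2") (auto simp: coords coords_sum_e \<alpha>_\<beta>_def(2) simp del: scale_minus_left)
  qed (use n in \<open>auto simp: coords coords_sum_e X_x X_y simp del: scale_minus_left\<close>)
  \<comment> \<open>Coordinate \<open>i\<close> of \<open>[X, a] = - a\<close> gives
    \<open>co a i\<close> as \<open>- \<alpha>\<close> times the coordinate of \<open>X\<close>
    preceding \<open>i\<close>. For \<open>i = 3\<close> this is \<open>\<beta>\<close>, to which
    \<open>Xi\<close> does not apply.\<close>
  have ai: "co a i = \<alpha> * exp_coeff \<beta> (i - 2)" if "3 \<le> i" "i \<le> n" for i
  proof (cases "i = 3")
    case True
    have "- co a 3 = co X 1 * co a 1"
      using co_br[of 3 X a] n by (simp add: x_e1 cxy coords)
    then have "co a 3 = - (co X 1 * co a 1)"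
      by (metis minus_minus)
    then show ?thesis
      using True by (simp add: \<alpha>_\<beta>_def exp_coeff_def)
  next
    case False
    then have "i - 1 - 1 = i - 2" "3 \<le> i - 1" using that by auto
    then show ?thesis
      using co_br[of i X a] False that Xi[of "i - 1"]
      by (simp add: x_e1 cxy coords \<alpha>_\<beta>_def)
  qed
  have a: "a = \<alpha> *s e 1 + (\<Sum>i = 3..n. (\<alpha> * exp_coeff \<beta> (i - 2)) *s e i)"
  proof (rule coords_eqI)
    fix i assume "1 \<le> i" "i \<le> n"
    then show "co a i = co (\<alpha> *s e 1 + (\<Sum>i = 3..n. (\<alpha> * exp_coeff \<beta> (i - 2)) *s e i)) i"
      using n a2 ai[of i]
      by (cases "i = 1"; cases "i = 2") (auto simp: coords coords_sum_e \<alpha>_\<beta>_def(1))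
  qed (use n in \<open>auto simp: coords coords_sum_e cxy\<close>)
  \<comment> \<open>As \<open>cx a = 0\<close>, right multiplication by \<open>a\<close> shifts
    coordinates from 3 on and scales them by \<open>\<alpha>\<close>; it sends \<open>a\<close> to
    \<open>\<phi> (e 3)\<close> and \<open>\<phi> (e i)\<close> to
    \<open>\<phi> (e (i + 1))\<close>.\<close>
  have ei: "\<phi> (e i) = (\<Sum>j = i..n. (\<alpha> ^ (i - 1) * exp_coeff \<beta> (j - i)) *s e j)"
    if "3 \<le> i" "i \<le> n" for i
    using that
  proof (induction i rule: nat_induct_at_least)
    case base
    have "br a a = (\<Sum>j = 3..n. (\<alpha> ^ (3 - 1) * exp_coeff \<beta> (j - 3)) *s e j)"
    proof (rule coords_eqI)
      fix k assume k: "1 \<le> k" "k \<le> n"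
      have [simp]: "k - 1 - 2 = k - 3" by simp
      show "co (br a a) k = co (\<Sum>j = 3..n. (\<alpha> ^ (3 - 1) * exp_coeff \<beta> (j - 3)) *s e j) k"
        using k ai[of "k - 1"]
        by (auto simp: co_br cxy coords_sum_e exp_coeff_0 power2_eq_square \<alpha>_\<beta>_def(1))
    qed (auto simp: cxy_br coords_sum_e)
    then show ?case by (simp add: e1_e1)
  next
    case (Suc i)
    have "br (\<phi> (e i)) a =
      (\<Sum>j = Suc i..n. (\<alpha> ^ (Suc i - 1) * exp_coeff \<beta> (j - Suc i)) *s e j)"
    proof (rule coords_eqI)
      fix k assume k: "1 \<le> k" "k \<le> n"
      have "\<alpha> ^ i = \<alpha> * \<alpha> ^ (i - 1)"
        using Suc.hyps by (cases i) auto
      moreover have "k - 1 - i = k - Suc i" by simp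
      ultimately show "co (br (\<phi> (e i)) a) k =
          co (\<Sum>j = Suc i..n. (\<alpha> ^ (Suc i - 1) * exp_coeff \<beta> (j - Suc i)) *s e j) k"
        using k Suc by (auto simp: co_br cxy coords_sum_e \<alpha>_\<beta>_def(1) simp del: diff_diff_left)
    qed (auto simp: cxy_br coords_sum_e)
    moreover have "br (\<phi> (e i)) a = \<phi> (e (Suc i))"
      using Suc.hyps Suc.prems n by (simp add: defs br_basis Suc_eq_plus1 flip: hom)
    ultimately show ?case by simp
  qed
  have "normal_form \<phi> \<alpha> \<beta> (co b 2) (co Y 2)"
    unfolding normal_form_def using a b X Y ei by (simp add: defs)
  moreover have "\<alpha> * co b 2 \<noteq> 0"
    using a1 b2 by (simp add: \<alpha>_\<beta>_def)
  ultimately show ?thesis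
    using that by blast
qed

section \<open>Sufficiency: the homomorphism property\<close>

lemma br_right_eq_0:
  assumes "co v 1 = 0" "co v 2 = 0" "cx v = 0" "cy v = 0"
  shows "br u v = 0"
  by (rule coords_eqI) (use assms in \<open>auto simp: co_br cxy_br coords\<close>)

lemma hom_if_hom_on_basis:
  assumes lin: "Vector_Spaces.linear scale scale \<phi>"
    and hom: "\<And>b c. b \<in> basis \<Longrightarrow> c \<in> basis \<Longrightarrow> \<phi> (br b c) = br (\<phi> b) (\<phi> c)"
  shows "\<phi> (br u v) = br (\<phi> u) (\<phi> v)"
proof -
  interpret \<phi>: Vector_Spaces.linear scale scale \<phi> by (rule lin)
  note \<phi>.zero [simp] \<phi>.add [simp] \<phi>.scale [simp]
  have "\<phi> (br b v) = br (\<phi> b) (\<phi> v)" if b: "b \<in> basis" for b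
    by (induction v rule: basis_induct) (use hom[OF b] in \<open>auto simp: br_linear in_basis\<close>)
  then show ?thesis
    by (induction u rule: basis_induct) (auto simp: br_linear in_basis)
qed

context
  fixes \<phi> and \<alpha> \<beta> \<gamma> \<delta>
  assumes nf: "normal_form \<phi> \<alpha> \<beta> \<gamma> \<delta>"
begin

lemma coords_image_e1:
  "co (\<phi> (e 1)) k =
    (if k = 1 then \<alpha> else if 3 \<le> k \<and> k \<le> n then \<alpha> * exp_coeff \<beta> (k - 2) else 0)"
  "cx (\<phi> (e 1)) = 0" "cy (\<phi> (e 1)) = 0"
  using nf n_ge_3 unfolding normal_form_def by (simp_all add: coords coords_sum_e)

lemma coords_image_e2:
  "co (\<phi> (e 2)) k = (if k = 2 then \<gamma> else 0)" "cx (\<phi> (e 2)) = 0" "cy (\<phi> (e 2)) = 0"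
  using nf n_ge_3 unfolding normal_form_def by (simp_all add: coords coords_sum_e)

lemma coords_image_ei:
  assumes "3 \<le> i" "i \<le> n"
  shows "co (\<phi> (e i)) k = (if i \<le> k \<and> k \<le> n then \<alpha> ^ (i - 1) * exp_coeff \<beta> (k - i) else 0)"
    and "cx (\<phi> (e i)) = 0" and "cy (\<phi> (e i)) = 0"
  using nf assms n_ge_3 unfolding normal_form_def by (simp_all add: coords coords_sum_e)

lemma coords_image_x:
  "co (\<phi> x) k =
    (if k = 1 then \<beta> else if 3 \<le> k \<and> k \<le> n then - exp_coeff \<beta> (k - 1) else 0)"
  "cx (\<phi> x) = 1" "cy (\<phi> x) = 0"
  using nf n_ge_3 unfolding normal_form_def
  by (simp_all add: coords coords_sum_e del: scale_minus_left)

lemma coords_image_y: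
  "co (\<phi> y) k = (if k = 2 then \<delta> else 0)" "cx (\<phi> y) = 0" "cy (\<phi> y) = 1"
  using nf n_ge_3 unfolding normal_form_def by (simp_all add: coords coords_sum_e)

lemmas coords_image =
  coords_image_e1 coords_image_e2 coords_image_ei coords_image_x coords_image_y

text \<open>The cases follow the right factor first: right multiplication by \<open>e i\<close> with
  \<open>i \<ge> 3\<close> and by its image vanish, and the substance lies in the right factors
  \<open>e 1\<close> and \<open>x\<close>.\<close>

lemma normal_form_hom_basis:
  assumes lin: "Vector_Spaces.linear scale scale \<phi>" and "b \<in> basis" "c \<in> basis"
  shows "\<phi> (br b c) = br (\<phi> b) (\<phi> c)"
proof -
  interpret \<phi>: Vector_Spaces.linear scale scale \<phi> by (rule lin)
  note [simp] = \<phi>.zero \<phi>.neg \<phi>.scale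
  note n = n_ge_3 and One_nat_def [simp del]
  have basis_cases: "d = e 1 \<or> d = e 2 \<or> (\<exists>i\<ge>3. i \<le> n \<and> d = e i) \<or> d = x \<or> d = y"
    if d: "d \<in> basis" for d
  proof -
    have "i = 1 \<or> i = 2 \<or> 3 \<le> i" if "1 \<le> i" for i :: nat
      using that by auto
    then show ?thesis
      using d by (fastforce simp: basis_def)
  qed
  consider "c = e 1" | "c = e 2" | i where "3 \<le> i" "i \<le> n" "c = e i" | "c = x" | "c = y"
    using basis_cases[OF assms(3)] by blast
  then show ?thesis
  proof cases
    \<comment> \<open>Right multiplication by \<open>\<phi> (e 1)\<close> is the shift scaled by
      \<open>\<alpha>\<close> in coordinates from 3 on, so exponents of \<open>exp_coeff\<close>
      only have to be realigned.\<close>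
    case 1
    consider "b = e 1" | "b = e 2" | i where "3 \<le> i" "i \<le> n" "b = e i" | "b = x" | "b = y"
      using basis_cases[OF assms(2)] by blast
    then show ?thesis
    proof cases
      case a: 1
      show ?thesis
      proof (rule coords_eqI)
        fix k assume k: "1 \<le> k" "k \<le> n"
        have "k - 1 - 2 = k - 3" by simp
        then show "co (\<phi> (br b c)) k = co (br (\<phi> b) (\<phi> c)) k"
          using 1 a k n by (auto simp: br_basis co_br coords_image exp_coeff_0 power2_eq_square)
      qed (use 1 a n in \<open>auto simp: br_basis cxy_br coords_image\<close>)
    next
      case a: (3 i)
      show ?thesis
      proof (rule coords_eqI)
        fix k assume k: "1 \<le> k" "k \<le> n"
        have "\<alpha> ^ i = \<alpha> * \<alpha> ^ (i - 1)"
          using a by (cases i) auto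
        moreover have "k - 1 - i = k - (i + 1)" by simp
        ultimately show "co (\<phi> (br b c)) k = co (br (\<phi> b) (\<phi> c)) k"
          \<comment> \<open>For \<open>i = n\<close> the product \<open>[e n, e 1]\<close> is 0, and
            the shift moves the only coordinate of \<open>\<phi> (e n)\<close> out of range.\<close>
          using 1 a k n by (cases "i = n")
            (auto simp: br_basis co_br coords coords_image simp del: diff_diff_left)
      qed (use 1 a n in \<open>auto simp: br_basis cxy_br coords coords_image\<close>)
    next
      case a: 4
      show ?thesis
      proof (rule coords_eqI)
        fix k assume k: "1 \<le> k" "k \<le> n"
        have "k - 1 - 1 = k - 2" by simp
        then show "co (\<phi> (br b c)) k = co (br (\<phi> b) (\<phi> c)) k"
          using 1 a k n by (auto simp: br_basis co_br coords coords_image exp_coeff_def)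
      qed (use 1 a n in \<open>auto simp: br_basis cxy_br coords coords_image\<close>)
    qed (use 1 n in \<open>auto intro!: coords_eqI simp: br_basis cxy_br co_br coords coords_image\<close>)
  next
    \<comment> \<open>In coordinates from 3 on, right multiplication by \<open>\<phi> x\<close> is
      the diagonal action of \<open>x\<close> plus \<open>\<beta>\<close> times the shift, and
      \<open>exp_coeff_step\<close> makes the shift cancel the excess of the diagonal.\<close>
    case 4
    consider "b = e 1" | "b = e 2" | i where "3 \<le> i" "i \<le> n" "b = e i" | "b = x" | "b = y"
      using basis_cases[OF assms(2)] by blast
    then show ?thesis
    proof cases
      case a: 1
      show ?thesis
      proof (rule coords_eqI)
        fix k assume k: "1 \<le> k" "k \<le> n"
        consider "k = 1" | "k = 2" | "k = 3" | "k > 3" using k by linarith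
        then show "co (\<phi> (br b c)) k = co (br (\<phi> b) (\<phi> c)) k"
        proof cases
          case 4
          \<comment> \<open>Here 1 is the eigenvalue of \<open>x\<close> on \<open>e 1\<close>; the
            rest is absorbed by the recursion.\<close>
          then have "of_nat (k - 1) = 1 + (of_nat (k - 2) :: complex)"
            by (simp add: of_nat_diff)
          moreover have "of_nat (k - 2) * exp_coeff \<beta> (k - 2) = - \<beta> * exp_coeff \<beta> (k - 1 - 2)"
            using exp_coeff_step[of "k - 2" \<beta>] 4 by (simp add: numeral_3_eq_3)
          ultimately have "\<alpha> * exp_coeff \<beta> (k - 1 - 2) * \<beta> +
              of_nat (k - 1) * (\<alpha> * exp_coeff \<beta> (k - 2)) = \<alpha> * exp_coeff \<beta> (k - 2)"
            by algebra
          moreover have "co (br (\<phi> b) (\<phi> c)) k = \<alpha> * exp_coeff \<beta> (k - 1 - 2) * \<beta> +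
              of_nat (k - 1) * (\<alpha> * exp_coeff \<beta> (k - 2))"
            using 4 \<open>c = x\<close> a k n by (auto simp: co_br coords_image)
          ultimately show ?thesis
            using 4 \<open>c = x\<close> a k n by (simp add: br_basis coords_image)
        qed (use \<open>c = x\<close> a k n in \<open>auto simp: br_basis co_br coords_image exp_coeff_def\<close>)
      qed (use 4 a n in \<open>auto simp: br_basis cxy_br coords_image\<close>)
    next
      case a: (3 i)
      show ?thesis
      proof (rule coords_eqI)
        fix k assume k: "1 \<le> k" "k \<le> n"
        consider "k < i" | "k = i" | "k > i" using k by linarith
        then show "co (\<phi> (br b c)) k = co (br (\<phi> b) (\<phi> c)) k"
        proof cases
          case k_gt: 3
          \<comment> \<open>The same splitting, with the eigenvalue \<open>i - 1\<close> of
            \<open>x\<close> on \<open>e i\<close>.\<close>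
          then have "of_nat (k - 1) = of_nat (i - 1) + (of_nat (k - i) :: complex)"
            using a by (simp flip: of_nat_add)
          moreover have "of_nat (k - i) * exp_coeff \<beta> (k - i) = - \<beta> * exp_coeff \<beta> (k - 1 - i)"
            using exp_coeff_step[of "k - i" \<beta>] k_gt by (simp only: diff_commute)
          ultimately have "p * exp_coeff \<beta> (k - 1 - i) * \<beta> +
              of_nat (k - 1) * (p * exp_coeff \<beta> (k - i)) = of_nat (i - 1) * (p * exp_coeff \<beta> (k - i))"
            for p by algebra
          moreover have "co (br (\<phi> b) (\<phi> c)) k = \<alpha> ^ (i - 1) * exp_coeff \<beta> (k - 1 - i) * \<beta> +
              of_nat (k - 1) * (\<alpha> ^ (i - 1) * exp_coeff \<beta> (k - i))"
            using 4 a k k_gt n by (auto simp: co_br coords_image)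
          moreover have "co (\<phi> (br b c)) k = of_nat (i - 1) * (\<alpha> ^ (i - 1) * exp_coeff \<beta> (k - i))"
            using 4 a k k_gt n by (auto simp: br_basis coords coords_image)
          ultimately show ?thesis
            by simp
        qed (use 4 a k n in \<open>auto simp: br_basis co_br coords coords_image\<close>)
      qed (use 4 a n in \<open>auto simp: br_basis cxy_br coords coords_image\<close>)
    next
      case a: 4
      show ?thesis
      proof (rule coords_eqI)
        fix k assume k: "1 \<le> k" "k \<le> n"
        consider "k = 1" | "k = 2" | "k = 3" | "k > 3" using k by linarith
        then show "co (\<phi> (br b c)) k = co (br (\<phi> b) (\<phi> c)) k"
        proof cases
          case k_gt: 4
          have "of_nat (k - 1) * exp_coeff \<beta> (k - 1) = - \<beta> * exp_coeff \<beta> (k - 1 - 1)"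
            using k_gt by (intro exp_coeff_step) simp
          moreover have "co (br (\<phi> b) (\<phi> c)) k =
              - exp_coeff \<beta> (k - 1 - 1) * \<beta> + of_nat (k - 1) * (- exp_coeff \<beta> (k - 1))"
            using 4 a k n k_gt by (auto simp: co_br coords_image)
          ultimately show ?thesis
            using 4 a n by (simp add: br_basis coords)
        qed (use 4 a k n in
              \<open>auto simp: br_basis co_br coords coords_image exp_coeff_def power2_eq_square\<close>)
      qed (use 4 a n in \<open>auto simp: br_basis cxy_br coords coords_image\<close>)
    qed (use 4 n in \<open>auto intro!: coords_eqI simp: br_basis cxy_br co_br coords coords_image\<close>)
  next
    case (3 i)
    have "br b c = 0" "br (\<phi> b) (\<phi> c) = 0"
      using 3 n by (auto intro!: br_right_eq_0 simp: coords coords_image)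
    then show ?thesis by simp
  next
    case 2
    then show ?thesis
      using basis_cases[OF assms(2)] n
      by (auto intro!: coords_eqI simp: br_basis cxy_br co_br coords coords_image)
  next
    case 5
    then show ?thesis
      using basis_cases[OF assms(2)] n
      by (auto intro!: coords_eqI simp: br_basis cxy_br co_br coords coords_image)
  qed
qed

section \<open>Sufficiency: bijectivity\<close>

lemma normal_form_surj:
  assumes lin: "Vector_Spaces.linear scale scale \<phi>" and ne: "\<alpha> * \<gamma> \<noteq> 0"
  shows "surj \<phi>"
proof -
  interpret \<phi>: Vector_Spaces.linear scale scale \<phi> by (rule lin)
  have sub: "subspace (range \<phi>)"
    by (rule \<phi>.subspace_image) simp
  note sub_add = subspace_add[OF sub] and sub_diff = subspace_diff[OF sub]
    and sub_scale = subspace_scale[OF sub] and sub_sum = subspace_sum[OF sub]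
  have scaleD: "v \<in> range \<phi>" if "c *s v \<in> range \<phi>" "c \<noteq> 0" for c v
    using sub_scale[OF that(1), of "inverse c"] that(2) by simp
  have ei: "e i \<in> range \<phi>" if "3 \<le> i" "i \<le> n" for i
    using that
  \<comment> \<open>Back substitution downwards from \<open>e n\<close>, where the tail sum is
    empty; the diagonal entry is \<open>\<alpha> ^ (i - 1) \<noteq> 0\<close>.\<close>
  proof (induction "n - i" arbitrary: i rule: less_induct)
    case less
    have "(\<Sum>j = Suc i..n. (\<alpha> ^ (i - 1) * exp_coeff \<beta> (j - i)) *s e j) \<in> range \<phi>"
      using less by (intro sub_sum sub_scale) auto
    moreover have "\<phi> (e i) = (\<Sum>j = i..n. (\<alpha> ^ (i - 1) * exp_coeff \<beta> (j - i)) *s e j)"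
      using less.prems nf unfolding normal_form_def by blast
    then have "\<alpha> ^ (i - 1) *s e i =
        \<phi> (e i) - (\<Sum>j = Suc i..n. (\<alpha> ^ (i - 1) * exp_coeff \<beta> (j - i)) *s e j)"
      by (simp add: sum.atLeast_Suc_atMost[OF less.prems(2)] exp_coeff_0)
    ultimately have "\<alpha> ^ (i - 1) *s e i \<in> range \<phi>"
      by (simp add: sub_diff)
    then show ?case
      by (rule scaleD) (use ne in simp)
  qed
  have tail: "(\<Sum>j = 3..n. f j *s e j) \<in> range \<phi>" for f
    using ei by (intro sub_sum sub_scale) auto
  have "\<alpha> *s e 1 = \<phi> (e 1) - (\<Sum>i = 3..n. (\<alpha> * exp_coeff \<beta> (i - 2)) *s e i)"
    using nf unfolding normal_form_def by (metis add_diff_cancel_right')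
  also have "\<dots> \<in> range \<phi>"
    by (intro sub_diff tail rangeI)
  finally have e1: "e 1 \<in> range \<phi>"
    by (rule scaleD) (use ne in simp)
  have "\<gamma> *s e 2 = \<phi> (e 2)"
    using nf unfolding normal_form_def by simp
  also have "\<dots> \<in> range \<phi>"
    by (rule rangeI)
  finally have e2: "e 2 \<in> range \<phi>"
    by (rule scaleD) (use ne in simp)
  have "x = \<phi> x - (\<beta> *s e 1 + (\<Sum>i = 3..n. (- exp_coeff \<beta> (i - 1)) *s e i))"
    using nf unfolding normal_form_def by (metis add_diff_cancel_left')
  also have "\<dots> \<in> range \<phi>"
    by (intro sub_diff sub_add sub_scale e1 tail rangeI)
  finally have x: "x \<in> range \<phi>" .
  have "y = \<phi> y - \<delta> *s e 2"
    using nf unfolding normal_form_def by (metis add_diff_cancel_left')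
  also have "\<dots> \<in> range \<phi>"
    by (intro sub_diff sub_scale e2 rangeI)
  finally have y: "y \<in> range \<phi>" .
  have "e i \<in> range \<phi>" if "1 \<le> i" "i \<le> n" for i
    using ei[of i] e1 e2 that by (cases "i = 1"; cases "i = 2") auto
  then have "basis \<subseteq> range \<phi>"
    using x y by (auto simp: basis_def)
  then have "span basis \<subseteq> range \<phi>"
    using sub by (rule span_minimal)
  then show ?thesis
    using span_basis by auto
qed

lemma normal_form_imp_automorphism:
  assumes lin: "Vector_Spaces.linear scale scale \<phi>" and ne: "\<alpha> * \<gamma> \<noteq> 0"
  shows "leibniz_automorphism scale br \<phi>"
proof -
  \<comment> \<open>Finite dimension makes the surjective linear map injective.\<close>
  interpret fin: finite_dimensional_vector_space scale basis
    by unfold_locales (use finite_basis independent_basis span_basis in auto)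
  have "surj \<phi>"
    using lin ne by (rule normal_form_surj)
  moreover from this have "inj \<phi>"
    using lin by (rule fin.linear_surj_imp_inj[rotated])
  moreover have "\<phi> (br u v) = br (\<phi> u) (\<phi> v)" for u v
    by (rule hom_if_hom_on_basis[OF lin]) (rule normal_form_hom_basis[OF lin])
  ultimately show ?thesis
    using lin by (simp add: leibniz_automorphism_def bij_def)
qed

end

end

section \<open>The classification with explicit coefficients\<close>

theorem theorem0p3p3:
  fixes scale :: "complex \<Rightarrow> 'a::ab_group_add \<Rightarrow> 'a" (infixr \<open>*s\<close> 75)
    and br :: "'a \<Rightarrow> 'a \<Rightarrow> 'a"
    and n :: nat
    and e :: "nat \<Rightarrow> 'a"
    and x y :: 'a
    and \<phi> :: "'a \<Rightarrow> 'a"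
  assumes "3 \<le> n"
    and "R2_algebra scale br n e x y"
    and "Vector_Spaces.linear scale scale \<phi>"
  shows "leibniz_automorphism scale br \<phi> \<longleftrightarrow>
    (\<exists>\<alpha> \<beta> \<gamma> \<delta> :: complex. \<alpha> * \<gamma> \<noteq> 0 \<and>
      \<phi> (e 1) = \<alpha> *s e 1 + (\<Sum>i = 3..n. ((-1) ^ i * \<alpha> * \<beta> ^ (i - 2) / fact (i - 2)) *s e i) \<and>
      \<phi> (e 2) = \<gamma> *s e 2 \<and>
      (\<forall>i. 3 \<le> i \<and> i \<le> n \<longrightarrow>
        \<phi> (e i) = (\<Sum>j = i..n. ((-1) ^ (j - i) * \<alpha> ^ (i - 1) * \<beta> ^ (j - i) / fact (j - i)) *s e j)) \<and>
      \<phi> x = \<beta> *s e 1 + (\<Sum>i = 3..n. ((-1) ^ i * \<beta> ^ (i - 1) / fact (i - 1)) *s e i) + x \<and>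
      \<phi> y = \<delta> *s e 2 + y)"
proof -
  interpret R2_algebra_ge_3 scale br n e x y
    using assms(1,2) by (intro R2_algebra_ge_3.intro R2_algebra_ge_3_axioms.intro)
  \<comment> \<open>The exponent drops by 2 in the image of \<open>e 1\<close> but by 1 in that of
    \<open>x\<close>, whence the minus sign there in \<open>normal_form\<close>.\<close>
  have parity: "(-1) ^ i = (-1 :: complex) ^ (i - 2)" "(-1) ^ i = - ((-1 :: complex) ^ (i - 1))"
    if "3 \<le> i" for i :: nat
    using that by (auto simp: minus_one_power_iff)
  have neg_pow: "(- b) ^ k = (-1) ^ k * b ^ k" for b :: complex and k
    by (rule power_minus)
  have coeff1: "(-1) ^ i * \<alpha> * \<beta> ^ (i - 2) / fact (i - 2) = \<alpha> * exp_coeff \<beta> (i - 2)"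
    if "i \<in> {3..n}" for \<alpha> \<beta> :: complex and i
    using that by (simp add: exp_coeff_def neg_pow[of \<beta>] parity(1)[of i])
  have coeff2: "(-1) ^ i * \<beta> ^ (i - 1) / fact (i - 1) = - exp_coeff \<beta> (i - 1)"
    if "i \<in> {3..n}" for \<beta> :: complex and i
    using that by (simp add: exp_coeff_def neg_pow[of \<beta>] parity(2)[of i])
  have coeff3: "(-1) ^ k * \<alpha> ^ m * \<beta> ^ k / fact k = \<alpha> ^ m * exp_coeff \<beta> k"
    for \<alpha> \<beta> :: complex and k m
    by (simp add: exp_coeff_def neg_pow[of \<beta>])
  have "leibniz_automorphism scale br \<phi> \<longleftrightarrow>
      (\<exists>\<alpha> \<beta> \<gamma> \<delta>. \<alpha> * \<gamma> \<noteq> 0 \<and> normal_form \<phi> \<alpha> \<beta> \<gamma> \<delta>)"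
    using automorphism_imp_normal_form[of \<phi>] normal_form_imp_automorphism[OF _ assms(3)] by metis
  then show ?thesis
    \<comment> \<open>The congruence rule supplies \<open>i \<in> {3..n}\<close>, the condition of
      \<open>coeff1\<close> and \<open>coeff2\<close>.\<close>
    by (simp only: normal_form_def coeff1 coeff2 coeff3 cong: sum.cong)
qed

end
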